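(* Let $M$ be a monoid with identity $e$, $X$ a left zero semigroup (i.e. $xy=x$ for all $x,y\in X$) and $\alpha$ a strong partial action of $M$ on $X$. Endow the set $X_M$ with the left zero semigroup structure, let $\beta=\{\beta_n\}_{n\in M}$ be the global action of $M$ on $X_M$ given by $\beta_n([m,x])=[nm,x]$, and let $\iota:X\to X_M$, $\iota(x)=[e,x]$. Then $(\beta,\iota)$ is a globalization of $\alpha$ (in the category of semigroups).
   Context: Let $M$ be a monoid with identity $e$. A strong partial action of $M$ on a set $X$ is a family $\alpha=\{\alpha_m:\operatorname{dom}\alpha_m\to X\}_{m\in M}$ of maps with $\operatorname{dom}\alpha_m\subseteq X$ such that: (1) $\operatorname{dom}\alpha_e=X$ and $\alpha_e=\mathrm{id}_X$; (2) $\alpha_m^{-1}(\operatorname{dom}\alpha_n)=\operatorname{dom}\alpha_{nm}\cap\operatorname{dom}\alpha_m$ for all $m,n\in M$; (3) $\alpha_n\circ\alpha_m=\alpha_{nm}$ on $\alpha_m^{-1}(\operatorname{dom}\alpha_n)$ for all $m,n\in M$. It is a global action if $\operatorname{dom}\alpha_m=X$ for all $m$. A strong partial action (global action) of $M$ on a semigroup $X$ is one on the underlying set such that each $\operatorname{dom}\alpha_m$ is a (possibly empty) subsemigroup of $X$ and each $\alpha_m$ is a semigroup homomorphism. If $\alpha$ is a strong partial action of $M$ on a semigroup $X$ and $\beta$ is a global action of $M$ on a semigroup $Y$, a morphism $\iota:\alpha\to\beta$ is a semigroup homomorphism $\iota:X\to Y$ with $\beta_m(\iota(x))=\iota(\alpha_m(x))$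 for all $m\in M$, $x\in\operatorname{dom}\alpha_m$. A globalization of $\alpha$ is a pair $(\beta,\iota)$, with $\beta$ a global action of $M$ on a semigroup and $\iota:\alpha\to\beta$ a morphism, such that for all $x,y\in X$ and $m\in M$ with $\beta_m(\iota(x))=\iota(y)$ one has $x\in\operatorname{dom}\alpha_m$ and $\alpha_m(x)=y$. $X_M=(M\times X)/{\approx}$, where $\approx$ is the equivalence relation generated by: $(m,x)\rightharpoonup(n,y)$ iff there is $k\in M$ with $m=nk$, $x\in\operatorname{dom}\alpha_k$ and $y=\alpha_k(x)$. The class of $(m,x)$ is $[m,x]$. The maps $\beta_n$ are well defined. *)

theory Defs
  imports "HOL-Algebra.Group"
begin

text \<open>
  Semigroups are given by an explicit carrier and a binary operation; the carrier may be empty.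
\<close>

locale carrier_semigroup =
  fixes S :: "'a set" and f :: "'a \<Rightarrow> 'a \<Rightarrow> 'a"
  assumes closed: "\<lbrakk>x \<in> S; y \<in> S\<rbrakk> \<Longrightarrow> f x y \<in> S"
    and assoc: "\<lbrakk>x \<in> S; y \<in> S; z \<in> S\<rbrakk> \<Longrightarrow> f (f x y) z = f x (f y z)"

locale left_zero_semigroup = carrier_semigroup +
  assumes left_zero: "\<lbrakk>x \<in> S; y \<in> S\<rbrakk> \<Longrightarrow> f x y = x"

definition subsemigroup :: "'a set \<Rightarrow> 'a set \<Rightarrow> ('a \<Rightarrow> 'a \<Rightarrow> 'a) \<Rightarrow> bool" where
  "subsemigroup T S f \<longleftrightarrow> T \<subseteq> S \<and> (\<forall>x\<in>T. \<forall>y\<in>T. f x y \<in> T)"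

definition semigroup_hom ::
  "'a set \<Rightarrow> ('a \<Rightarrow> 'a \<Rightarrow> 'a) \<Rightarrow> 'b set \<Rightarrow> ('b \<Rightarrow> 'b \<Rightarrow> 'b) \<Rightarrow> ('a \<Rightarrow> 'b) \<Rightarrow> bool" where
  "semigroup_hom S f T g h \<longleftrightarrow>
     h \<in> S \<rightarrow> T \<and> (\<forall>x\<in>S. \<forall>y\<in>S. h (f x y) = g (h x) (h y))"

text \<open>
  The maps \<open>\<alpha>\<^sub>m\<close> with their domains are partial functions: \<open>\<alpha> m x = None\<close> means
  that \<open>x\<close> is outside the domain of \<open>\<alpha>\<^sub>m\<close>. Only indices in \<open>carrier M\<close> matter.
\<close>

locale strong_partial_action = monoid M for M (structure) +
  fixes X :: "'x set" and \<alpha> :: "'m \<Rightarrow> 'x \<rightharpoonup> 'x"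
  assumes dom_subset: "m \<in> carrier M \<Longrightarrow> dom (\<alpha> m) \<subseteq> X"
    and ran_subset: "m \<in> carrier M \<Longrightarrow> ran (\<alpha> m) \<subseteq> X"
    and dom_one: "dom (\<alpha> \<one>) = X"
    and act_one: "x \<in> X \<Longrightarrow> \<alpha> \<one> x = Some x"
    and preimage_dom: "\<lbrakk>m \<in> carrier M; n \<in> carrier M\<rbrakk> \<Longrightarrow>
          {x \<in> dom (\<alpha> m). the (\<alpha> m x) \<in> dom (\<alpha> n)} = dom (\<alpha> (n \<otimes> m)) \<inter> dom (\<alpha> m)"
    and act_mult: "\<lbrakk>m \<in> carrier M; n \<in> carrier M; x \<in> dom (\<alpha> m); the (\<alpha> m x) \<in> dom (\<alpha> n)\<rbrakk> \<Longrightarrow>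
          \<alpha> n (the (\<alpha> m x)) = \<alpha> (n \<otimes> m) x"

locale strong_partial_action_on_semigroup =
  strong_partial_action M X \<alpha> + carrier_semigroup X f
  for M (structure) and X :: "'x set" and f :: "'x \<Rightarrow> 'x \<Rightarrow> 'x" and \<alpha> :: "'m \<Rightarrow> 'x \<rightharpoonup> 'x" +
  assumes dom_subsemigroup: "m \<in> carrier M \<Longrightarrow> subsemigroup (dom (\<alpha> m)) X f"
    and act_hom: "m \<in> carrier M \<Longrightarrow> semigroup_hom (dom (\<alpha> m)) f X f (\<lambda>x. the (\<alpha> m x))"

locale global_action_on_semigroup = strong_partial_action_on_semigroup +
  assumes dom_total: "m \<in> carrier M \<Longrightarrow> dom (\<alpha> m) = X"

definition action_morphism ::
  "('m, 'r) monoid_scheme \<Rightarrow> 'x set \<Rightarrow> ('x \<Rightarrow> 'x \<Rightarrow> 'x) \<Rightarrow> ('m \<Rightarrow> 'x \<rightharpoonup> 'x) \<Rightarrow>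
   'y set \<Rightarrow> ('y \<Rightarrow> 'y \<Rightarrow> 'y) \<Rightarrow> ('m \<Rightarrow> 'y \<rightharpoonup> 'y) \<Rightarrow> ('x \<Rightarrow> 'y) \<Rightarrow> bool" where
  "action_morphism M X f \<alpha> Y g \<beta> \<iota> \<longleftrightarrow>
     semigroup_hom X f Y g \<iota> \<and>
     (\<forall>m\<in>carrier M. \<forall>x\<in>dom (\<alpha> m). \<beta> m (\<iota> x) = Some (\<iota> (the (\<alpha> m x))))"

definition globalization ::
  "('m, 'r) monoid_scheme \<Rightarrow> 'x set \<Rightarrow> ('x \<Rightarrow> 'x \<Rightarrow> 'x) \<Rightarrow> ('m \<Rightarrow> 'x \<rightharpoonup> 'x) \<Rightarrow>
   'y set \<Rightarrow> ('y \<Rightarrow> 'y \<Rightarrow> 'y) \<Rightarrow> ('m \<Rightarrow> 'y \<rightharpoonup> 'y) \<Rightarrow> ('x \<Rightarrow> 'y) \<Rightarrow> bool" where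
  "globalization M X f \<alpha> Y g \<beta> \<iota> \<longleftrightarrow>
     global_action_on_semigroup M Y g \<beta> \<and>
     action_morphism M X f \<alpha> Y g \<beta> \<iota> \<and>
     (\<forall>x\<in>X. \<forall>y\<in>X. \<forall>m\<in>carrier M.
        \<beta> m (\<iota> x) = Some (\<iota> y) \<longrightarrow> x \<in> dom (\<alpha> m) \<and> \<alpha> m x = Some y)"

definition generated_equiv :: "'a set \<Rightarrow> ('a \<times> 'a) set \<Rightarrow> ('a \<times> 'a) set" where
  "generated_equiv A r = \<Inter> {R. equiv A R \<and> r \<subseteq> R}"

definition glob_step ::
  "('m, 'r) monoid_scheme \<Rightarrow> 'x set \<Rightarrow> ('m \<Rightarrow> 'x \<rightharpoonup> 'x) \<Rightarrow> (('m \<times> 'x) \<times> ('m \<times> 'x)) set" where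
  "glob_step M X \<alpha> =
     {((m, x), (n, y)) | m x n y. m \<in> carrier M \<and> x \<in> X \<and> n \<in> carrier M \<and> y \<in> X \<and>
        (\<exists>k\<in>carrier M. m = n \<otimes>\<^bsub>M\<^esub> k \<and> \<alpha> k x = Some y)}"

definition glob_rel ::
  "('m, 'r) monoid_scheme \<Rightarrow> 'x set \<Rightarrow> ('m \<Rightarrow> 'x \<rightharpoonup> 'x) \<Rightarrow> (('m \<times> 'x) \<times> ('m \<times> 'x)) set" where
  "glob_rel M X \<alpha> = generated_equiv (carrier M \<times> X) (glob_step M X \<alpha>)"

definition glob_carrier ::
  "('m, 'r) monoid_scheme \<Rightarrow> 'x set \<Rightarrow> ('m \<Rightarrow> 'x \<rightharpoonup> 'x) \<Rightarrow> ('m \<times> 'x) set set" where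
  "glob_carrier M X \<alpha> = (carrier M \<times> X) // glob_rel M X \<alpha>"

definition glob_class ::
  "('m, 'r) monoid_scheme \<Rightarrow> 'x set \<Rightarrow> ('m \<Rightarrow> 'x \<rightharpoonup> 'x) \<Rightarrow> 'm \<Rightarrow> 'x \<Rightarrow> ('m \<times> 'x) set" where
  "glob_class M X \<alpha> m x = glob_rel M X \<alpha> `` {(m, x)}"

text \<open>
  The action on classes is computed on representatives; \<open>glob_act_class\<close> below shows that the
  set of results is a singleton, so that \<open>the_elem\<close> is meaningful.
\<close>

definition glob_act ::
  "('m, 'r) monoid_scheme \<Rightarrow> 'x set \<Rightarrow> ('m \<Rightarrow> 'x \<rightharpoonup> 'x) \<Rightarrow> 'm \<Rightarrow> ('m \<times> 'x) set \<rightharpoonup> ('m \<times> 'x) set" where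
  "glob_act M X \<alpha> n c =
     (if c \<in> glob_carrier M X \<alpha>
      then Some (the_elem ((\<lambda>(m, x). glob_class M X \<alpha> (n \<otimes>\<^bsub>M\<^esub> m) x) ` c))
      else None)"

definition glob_incl ::
  "('m, 'r) monoid_scheme \<Rightarrow> 'x set \<Rightarrow> ('m \<Rightarrow> 'x \<rightharpoonup> 'x) \<Rightarrow> 'x \<Rightarrow> ('m \<times> 'x) set" where
  "glob_incl M X \<alpha> x = glob_class M X \<alpha> \<one>\<^bsub>M\<^esub> x"

lemma equiv_generated_equiv:
  assumes "r \<subseteq> A \<times> A"
  shows "equiv A (generated_equiv A r)"
proof -
  have "equiv A (A \<times> A)"
    by (auto simp: equiv_def refl_on_def sym_def trans_def)
  then have sub: "generated_equiv A r \<subseteq> A \<times> A"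
    using assms unfolding generated_equiv_def by blast
  show ?thesis
  proof (rule equivI[OF sub])
    show "refl_on A (generated_equiv A r)"
      by (auto simp: generated_equiv_def equiv_def refl_on_def)
    show "sym (generated_equiv A r)"
      unfolding generated_equiv_def by (rule symI) (auto simp: equiv_def dest: symD)
    show "trans (generated_equiv A r)"
      unfolding generated_equiv_def by (rule transI) (auto simp: equiv_def dest: transD)
  qed
qed

lemma generated_equiv_least: "equiv A R \<Longrightarrow> r \<subseteq> R \<Longrightarrow> generated_equiv A r \<subseteq> R"
  by (auto simp: generated_equiv_def)

lemma equiv_glob_rel: "equiv (carrier M \<times> X) (glob_rel M X \<alpha>)"
  unfolding glob_rel_def by (rule equiv_generated_equiv) (auto simp: glob_step_def)

lemma glob_step_subset_glob_rel: "glob_step M X \<alpha> \<subseteq> glob_rel M X \<alpha>"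
  by (auto simp: glob_rel_def generated_equiv_def)

lemma (in monoid) glob_act_class:
  assumes n: "n \<in> carrier G" and m: "m \<in> carrier G" and x: "x \<in> X"
  shows "glob_act G X \<alpha> n (glob_class G X \<alpha> m x) = Some (glob_class G X \<alpha> (n \<otimes> m) x)"
proof -
  let ?A = "carrier G \<times> X"
  let ?F = "\<lambda>(m, x). glob_class G X \<alpha> (n \<otimes> m) x"
  let ?R = "{(p, q). p \<in> ?A \<and> q \<in> ?A \<and> ?F p = ?F q}"
  have "equiv ?A ?R"
    by (auto simp: equiv_def refl_on_def sym_def trans_def)
  moreover have "glob_step G X \<alpha> \<subseteq> ?R"
  proof (rule subrelI)
    fix p q
    assume "(p, q) \<in> glob_step G X \<alpha>"
    moreover obtain a y b z where pq: "p = (a, y)" "q = (b, z)"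
      by fastforce
    ultimately have st: "((a, y), (b, z)) \<in> glob_step G X \<alpha>"
      by simp
    then have "((n \<otimes> a, y), (n \<otimes> b, z)) \<in> glob_step G X \<alpha>"
      using n by (auto simp: glob_step_def m_assoc)
    then have "((n \<otimes> a, y), (n \<otimes> b, z)) \<in> glob_rel G X \<alpha>"
      using glob_step_subset_glob_rel by blast
    then have "glob_class G X \<alpha> (n \<otimes> a) y = glob_class G X \<alpha> (n \<otimes> b) z"
      unfolding glob_class_def by (rule equiv_class_eq[OF equiv_glob_rel])
    then show "(p, q) \<in> ?R"
      using st pq by (auto simp: glob_step_def)
  qed
  ultimately have rel: "glob_rel G X \<alpha> \<subseteq> ?R"
    unfolding glob_rel_def by (rule generated_equiv_least)
  have mem: "(m, x) \<in> glob_class G X \<alpha> m x"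
    unfolding glob_class_def by (rule equiv_class_self[OF equiv_glob_rel]) (use m x in auto)
  have const: "?F q = ?F (m, x)" if "q \<in> glob_class G X \<alpha> m x" for q
  proof -
    have "((m, x), q) \<in> ?R"
      using that rel unfolding glob_class_def by blast
    then show ?thesis by simp
  qed
  have "?F ` glob_class G X \<alpha> m x = {?F (m, x)}"
    using const mem by blast
  moreover have "glob_class G X \<alpha> m x \<in> glob_carrier G X \<alpha>"
    unfolding glob_class_def glob_carrier_def by (rule quotientI) (use m x in auto)
  ultimately show ?thesis
    by (simp add: glob_act_def)
qed

end

(* The value "alpha_m x" (possibly undefined) is invariant under the steps generating the
   equivalence: if m = nk and y = alpha_k x, then strongness says exactly that alpha_m x and
   alpha_n y are either both undefined or equal.  Hence [m,x] = [e,y] forces alpha_m x = y.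
   The algebraic conditions are vacuous, because every map between left zero semigroups is a
   homomorphism. *)

theory Submission
  imports Defs
begin

lemma glob_class_in_glob_carrier:
  "\<lbrakk>m \<in> carrier M; x \<in> X\<rbrakk> \<Longrightarrow> glob_class M X \<alpha> m x \<in> glob_carrier M X \<alpha>"
  unfolding glob_class_def glob_carrier_def by (rule quotientI) auto

lemma glob_carrierE:
  assumes "c \<in> glob_carrier M X \<alpha>"
  obtains m x where "m \<in> carrier M" "x \<in> X" "c = glob_class M X \<alpha> m x"
  using assms unfolding glob_carrier_def glob_class_def by (auto elim!: quotientE)

lemma dom_glob_act: "dom (glob_act M X \<alpha> n) = glob_carrier M X \<alpha>"
  by (auto simp: glob_act_def dom_def)

text \<open>On representatives, \<open>n\<close> multiplies the first coordinate from the left, so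
  the action laws come down to the unit and associativity laws of the monoid. Every domain is the
  whole quotient, which settles the domain conditions.\<close>

lemma (in monoid) global_action_glob_act:
  "global_action_on_semigroup G (glob_carrier G X \<alpha>) (\<lambda>c d. c) (glob_act G X \<alpha>)"
proof -
  let ?C = "glob_carrier G X \<alpha>" and ?\<beta> = "glob_act G X \<alpha>"
  have closed: "the (?\<beta> n c) \<in> ?C" if "n \<in> carrier G" "c \<in> ?C" for n c
    using that by (auto elim!: glob_carrierE simp: glob_act_class glob_class_in_glob_carrier)
  show ?thesis
  proof unfold_locales
    fix n assume n: "n \<in> carrier G"
    show "ran (?\<beta> n) \<subseteq> ?C"
    proof
      fix d assume "d \<in> ran (?\<beta> n)"
      then obtain c where c: "?\<beta> n c = Some d" by (auto simp: ran_def)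
      then have "c \<in> ?C" using dom_glob_act by (metis domI)
      then show "d \<in> ?C" using closed[OF n] c by fastforce
    qed
    show "subsemigroup (dom (?\<beta> n)) ?C (\<lambda>c d. c)"
      by (simp add: dom_glob_act subsemigroup_def)
    show "semigroup_hom (dom (?\<beta> n)) (\<lambda>c d. c) ?C (\<lambda>c d. c) (\<lambda>x. the (?\<beta> n x))"
      using closed[OF n] by (auto simp: dom_glob_act semigroup_hom_def)
  next
    fix c assume "c \<in> ?C"
    then show "?\<beta> \<one> c = Some c"
      by (auto elim!: glob_carrierE simp: glob_act_class)
  next
    fix m n assume "m \<in> carrier G" "n \<in> carrier G"
    then show "{x \<in> dom (?\<beta> m). the (?\<beta> m x) \<in> dom (?\<beta> n)} = dom (?\<beta> (n \<otimes> m)) \<inter> dom (?\<beta> m)"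
      using closed by (auto simp: dom_glob_act)
  next
    fix m n c assume "m \<in> carrier G" "n \<in> carrier G" "c \<in> dom (?\<beta> m)"
    then show "?\<beta> n (the (?\<beta> m c)) = ?\<beta> (n \<otimes> m) c"
      by (auto simp: dom_glob_act glob_act_class m_assoc elim!: glob_carrierE)
  qed (auto simp: dom_glob_act)
qed

context strong_partial_action
begin

text \<open>An equality of options transfers definedness both ways along a step, as the symmetry of
  the generated equivalence requires.\<close>

lemma act_compose:
  assumes "k \<in> carrier M" "n \<in> carrier M" and x: "\<alpha> k x = Some y"
  shows "\<alpha> (n \<otimes> k) x = \<alpha> n y"
proof (cases "y \<in> dom (\<alpha> n)")
  case True
  then show ?thesis using act_mult[of k n x] assms by (auto simp: domI)
next
  case False
  \<comment> \<open>Since \<open>x\<close> lies in \<open>dom (\<alpha> k)\<close>, the set equation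
    \<open>preimage_dom\<close> read at \<open>x\<close> makes \<open>x\<close> belong to
    \<open>dom (\<alpha> (n \<otimes> k))\<close> exactly when \<open>y\<close> belongs to
    \<open>dom (\<alpha> n)\<close>.\<close>
  then have "x \<notin> dom (\<alpha> (n \<otimes> k))"
    using eqset_imp_iff[OF preimage_dom[of k n], of x] assms by (simp add: domI)
  with False show ?thesis by (simp add: domIff)
qed

text \<open>The kernel of the evaluation map \<open>case_prod \<alpha>\<close> on pairs is an
  equivalence containing every step, hence contains the generated one.\<close>

lemma act_eq_if_glob_rel:
  assumes "((m, x), (n, y)) \<in> glob_rel M X \<alpha>"
  shows "\<alpha> m x = \<alpha> n y"
proof -
  let ?A = "carrier M \<times> X"
  let ?R = "{(p, q). p \<in> ?A \<and> q \<in> ?A \<and> case_prod \<alpha> p = case_prod \<alpha> q}"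
  have "equiv ?A ?R"
    by (auto simp: equiv_def refl_on_def sym_def trans_def)
  moreover have "glob_step M X \<alpha> \<subseteq> ?R"
    by (auto simp: glob_step_def act_compose)
  ultimately have "glob_rel M X \<alpha> \<subseteq> ?R"
    unfolding glob_rel_def by (rule generated_equiv_least)
  then show ?thesis using assms by auto
qed

lemma act_eq_if_glob_class_eq:
  assumes "glob_class M X \<alpha> m x = glob_class M X \<alpha> n y" "n \<in> carrier M" "y \<in> X"
  shows "\<alpha> m x = \<alpha> n y"
  using assms eq_equiv_class[OF _ equiv_glob_rel]
  unfolding glob_class_def by (intro act_eq_if_glob_rel) blast

text \<open>One step suffices: factor \<open>m\<close> as \<open>\<one> \<otimes> m\<close> and take
  \<open>k = m\<close>.\<close>

lemma glob_class_act:
  assumes m: "m \<in> carrier M" and x: "\<alpha> m x = Some y"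
  shows "glob_class M X \<alpha> m x = glob_class M X \<alpha> \<one> y"
proof -
  have "x \<in> X" "y \<in> X"
    using dom_subset[OF m] ran_subset[OF m] x by (auto intro: domI ranI)
  then have "((m, x), (\<one>, y)) \<in> glob_step M X \<alpha>"
    using m x by (auto simp: glob_step_def)
  then show ?thesis
    unfolding glob_class_def
    by (intro equiv_class_eq[OF equiv_glob_rel]) (use glob_step_subset_glob_rel in blast)
qed

lemma glob_act_glob_incl:
  "\<lbrakk>m \<in> carrier M; x \<in> X\<rbrakk> \<Longrightarrow> glob_act M X \<alpha> m (glob_incl M X \<alpha> x) = Some (glob_class M X \<alpha> m x)"
  by (simp add: glob_incl_def glob_act_class)

end

theorem proposition4p13:
  fixes M :: "('m, 'r) monoid_scheme"
    and X :: "'x set"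
    and f :: "'x \<Rightarrow> 'x \<Rightarrow> 'x"
    and \<alpha> :: "'m \<Rightarrow> 'x \<rightharpoonup> 'x"
  assumes "monoid M"
    and "left_zero_semigroup X f"
    and "strong_partial_action_on_semigroup M X f \<alpha>"
  shows "globalization M X f \<alpha>
           (glob_carrier M X \<alpha>) (\<lambda>c d. c) (glob_act M X \<alpha>) (glob_incl M X \<alpha>)"
proof -
  interpret left_zero_semigroup X f by fact
  interpret strong_partial_action_on_semigroup M X f \<alpha> by fact
  let ?\<iota> = "glob_incl M X \<alpha>"
  have "semigroup_hom X f (glob_carrier M X \<alpha>) (\<lambda>c d. c) ?\<iota>"
    by (auto simp: semigroup_hom_def left_zero glob_incl_def glob_class_in_glob_carrier)
  moreover have "glob_act M X \<alpha> m (?\<iota> x) = Some (?\<iota> (the (\<alpha> m x)))"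
    if m: "m \<in> carrier M" and x: "x \<in> dom (\<alpha> m)" for m x
  proof -
    have "x \<in> X" using dom_subset[OF m] x by blast
    then show ?thesis
      using m x by (auto simp: glob_act_glob_incl glob_class_act simp flip: glob_incl_def)
  qed
  \<comment> \<open>The assumption says that the classes of \<open>(m, x)\<close> and
    \<open>(\<one>, y)\<close> agree, so evaluation gives
    \<open>\<alpha> m x = \<alpha> \<one> y\<close>, which is \<open>Some y\<close>. This also puts
    \<open>x\<close> in the domain.\<close>
  moreover have "\<alpha> m x = Some y"
    if "x \<in> X" "y \<in> X" "m \<in> carrier M" "glob_act M X \<alpha> m (?\<iota> x) = Some (?\<iota> y)" for m x y
    using that act_eq_if_glob_class_eq[of m x "\<one>\<^bsub>M\<^esub>" y]
    by (simp add: glob_act_glob_incl act_one flip: glob_incl_def)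
  ultimately show ?thesis
    unfolding globalization_def action_morphism_def
    using global_action_glob_act by blast
qed

end
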